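(* Let $x=x(s)$ be a regular curve in $\mathbb{E}^4$, parametrized by arclength $s$, with Frenet frame $T,N_1,N_2,N_3$ and nonzero Frenet curvatures $\kappa_1,\kappa_2,\kappa_3$. Let $\widetilde{x}=x+c_1N_1+c_2N_2+c_3N_3$ be its generalized evolute. Then the Frenet $4$-frame $\widetilde{T},\widetilde{N}_1,\widetilde{N}_2,\widetilde{N}_3$ and the Frenet curvatures $\widetilde{\kappa}_1,\widetilde{\kappa}_2,\widetilde{\kappa}_3$ of $\widetilde{x}$ are given by $$\widetilde{T}=N_3,\quad \widetilde{N}_1=-N_2,\quad \widetilde{N}_2=N_1,\quad \widetilde{N}_3=T,$$ and $$\widetilde{\kappa}_1=\frac{\kappa_3}{|\psi|},\qquad \widetilde{\kappa}_2=\frac{\kappa_2}{|\psi|},\qquad \widetilde{\kappa}_3=-\frac{\kappa_1}{|\psi|},$$ where $\psi(s)=c_2(s)\kappa_3(s)+c_3'(s)$ is a smooth function.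
   Context: Primes denote $d/ds$. For a curve $y$ in $\mathbb{E}^4$ with speed $v=\|y'\|$, the Frenet frame is an orthonormal frame $T=y'/\|y'\|,N_1,N_2,N_3$ along $y$, and the Frenet curvatures are functions $\kappa_1,\kappa_2,\kappa_3$, with $T'=v\kappa_1N_1$, $N_1'=v(-\kappa_1T+\kappa_2N_2)$, $N_2'=v(-\kappa_2N_1+\kappa_3N_3)$, $N_3'=-v\kappa_3N_2$. The generalized evolute (focal curve) of a unit speed curve $x$ is the curve of centers of its osculating hyperspheres, $\widetilde{x}=x+c_1N_1+c_2N_2+c_3N_3$ with focal curvatures $c_1=\rho=1/\kappa_1$, $c_2=\rho'/\kappa_2$, $c_3=\left(\rho\kappa_2+(\rho'/\kappa_2)'\right)/\kappa_3$.
   Formalization: The printed frame is asserted only where ψ>0; where ψ<0 the tangent of the evolute is −N₃, so the frame is corrected to (−N₃, N₂, −N₁, −T) with the same curvatures; points with ψ=0, where the evolute is not regular, are excluded. *)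

theory Defs
  imports "HOL-Analysis.Analysis"
begin

abbreviation D :: "(real \<Rightarrow> 'a::real_normed_vector) \<Rightarrow> real \<Rightarrow> 'a" where
  "D f \<equiv> (\<lambda>s. vector_derivative f (at s))"

(* C-infinity. Used for open S only, so derivatives at points of S depend only on f on S. *)
definition smooth_on :: "real set \<Rightarrow> (real \<Rightarrow> 'a::real_normed_vector) \<Rightarrow> bool" where
  "smooth_on S f \<longleftrightarrow> (\<forall>n. \<forall>s\<in>S. (D ^^ n) f differentiable (at s))"

definition orthonormal_frame :: "real ^ 4 \<Rightarrow> real ^ 4 \<Rightarrow> real ^ 4 \<Rightarrow> real ^ 4 \<Rightarrow> bool" where
  "orthonormal_frame e0 e1 e2 e3 \<longleftrightarrow>
     norm e0 = 1 \<and> norm e1 = 1 \<and> norm e2 = 1 \<and> norm e3 = 1 \<and>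
     e0 \<bullet> e1 = 0 \<and> e0 \<bullet> e2 = 0 \<and> e0 \<bullet> e3 = 0 \<and>
     e1 \<bullet> e2 = 0 \<and> e1 \<bullet> e3 = 0 \<and> e2 \<bullet> e3 = 0"

(* T, N1, N2, N3 is a Frenet frame of the regular curve y over the open set S, with Frenet
   curvatures k1, k2, k3; the speed of y is arbitrary.  The curvatures are signed and the
   orientation of the frame is not fixed: the Frenet equations determine N1, N2, N3 (and
   correspondingly k1, k2, k3) only up to sign (where the curvatures
   do not vanish), whereas T is determined by y. *)
definition frenet_apparatus ::
  "real set \<Rightarrow> (real \<Rightarrow> real ^ 4) \<Rightarrow>
   (real \<Rightarrow> real ^ 4) \<Rightarrow> (real \<Rightarrow> real ^ 4) \<Rightarrow> (real \<Rightarrow> real ^ 4) \<Rightarrow> (real \<Rightarrow> real ^ 4) \<Rightarrow>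
   (real \<Rightarrow> real) \<Rightarrow> (real \<Rightarrow> real) \<Rightarrow> (real \<Rightarrow> real) \<Rightarrow> bool" where
  "frenet_apparatus S y T N1 N2 N3 k1 k2 k3 \<longleftrightarrow>
     smooth_on S y \<and>
     smooth_on S T \<and> smooth_on S N1 \<and> smooth_on S N2 \<and> smooth_on S N3 \<and>
     smooth_on S k1 \<and> smooth_on S k2 \<and> smooth_on S k3 \<and>
     (\<forall>s\<in>S. let v = norm (D y s) in
        D y s \<noteq> 0 \<and>
        orthonormal_frame (T s) (N1 s) (N2 s) (N3 s) \<and>
        T s = D y s /\<^sub>R v \<and>
        (T has_vector_derivative v *\<^sub>R (k1 s *\<^sub>R N1 s)) (at s) \<and>
        (N1 has_vector_derivative v *\<^sub>R (- k1 s *\<^sub>R T s + k2 s *\<^sub>R N2 s)) (at s) \<and>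
        (N2 has_vector_derivative v *\<^sub>R (- k2 s *\<^sub>R N1 s + k3 s *\<^sub>R N3 s)) (at s) \<and>
        (N3 has_vector_derivative - (v * k3 s) *\<^sub>R N2 s) (at s))"

definition focal_c1 :: "(real \<Rightarrow> real) \<Rightarrow> real \<Rightarrow> real" where
  "focal_c1 k1 s = 1 / k1 s"

definition focal_c2 :: "(real \<Rightarrow> real) \<Rightarrow> (real \<Rightarrow> real) \<Rightarrow> real \<Rightarrow> real" where
  "focal_c2 k1 k2 s = D (focal_c1 k1) s / k2 s"

definition focal_c3 ::
  "(real \<Rightarrow> real) \<Rightarrow> (real \<Rightarrow> real) \<Rightarrow> (real \<Rightarrow> real) \<Rightarrow> real \<Rightarrow> real" where
  "focal_c3 k1 k2 k3 s = (focal_c1 k1 s * k2 s + D (focal_c2 k1 k2) s) / k3 s"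

definition generalized_evolute ::
  "(real \<Rightarrow> real ^ 4) \<Rightarrow> (real \<Rightarrow> real ^ 4) \<Rightarrow> (real \<Rightarrow> real ^ 4) \<Rightarrow> (real \<Rightarrow> real ^ 4) \<Rightarrow>
   (real \<Rightarrow> real) \<Rightarrow> (real \<Rightarrow> real) \<Rightarrow> (real \<Rightarrow> real) \<Rightarrow> real \<Rightarrow> real ^ 4" where
  "generalized_evolute x N1 N2 N3 k1 k2 k3 s =
     x s + focal_c1 k1 s *\<^sub>R N1 s + focal_c2 k1 k2 s *\<^sub>R N2 s + focal_c3 k1 k2 k3 s *\<^sub>R N3 s"

(* The velocity of the generalized evolute is psi N3, so its unit tangent is N3 where psi > 0
   and - N3 where psi < 0; it is regular exactly where psi is nonzero. *)
definition evolute_psi ::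
  "(real \<Rightarrow> real) \<Rightarrow> (real \<Rightarrow> real) \<Rightarrow> (real \<Rightarrow> real) \<Rightarrow> real \<Rightarrow> real" where
  "evolute_psi k1 k2 k3 s = focal_c2 k1 k2 s * k3 s + D (focal_c3 k1 k2 k3) s"

end

theory Submission
  imports Defs
begin

text \<open>By the choice of the focal curvatures, all components of the derivative of the evolute
  cancel except the one along \<open>N3\<close>, which equals \<open>\<psi>\<close>. So the evolute has
  speed \<open>\<bar>\<psi>\<bar>\<close>, and the Frenet equations of the evolute are those of \<open>x\<close>
  read backwards, with each curvature divided by the new speed.\<close>

section \<open>Smooth functions: derivatives and restriction\<close>

lemma smooth_on_differentiable: "smooth_on S f \<Longrightarrow> s \<in> S \<Longrightarrow> f differentiable (at s)"
  unfolding smooth_on_def by (metis funpow_0)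

lemma smooth_on_has_vector_derivative:
  "smooth_on S f \<Longrightarrow> s \<in> S \<Longrightarrow> (f has_vector_derivative D f s) (at s)"
  using smooth_on_differentiable vector_derivative_works by blast

lemma smooth_on_D: "smooth_on S f \<Longrightarrow> smooth_on S (D f)"
  unfolding smooth_on_def
proof (intro allI)
  fix n assume "\<forall>n. \<forall>s\<in>S. (D ^^ n) f differentiable (at s)"
  then have "\<forall>s\<in>S. (D ^^ Suc n) f differentiable (at s)" by blast
  then show "\<forall>s\<in>S. (D ^^ n) (D f) differentiable (at s)"
    by (simp only: funpow_Suc_right comp_apply)
qed

lemma smooth_on_subset: "smooth_on S f \<Longrightarrow> U \<subseteq> S \<Longrightarrow> smooth_on U f"
  unfolding smooth_on_def by blast

section \<open>Differentiability of finite order\<close>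

text \<open>A finite-order version of smoothness, so that closure properties can be proved by
  induction on the order. The order counts from zero: at order \<open>n\<close> the derivatives
  number 0 to \<open>n\<close> are all differentiable, so \<open>f\<close> itself is differentiable
  \<open>n + 1\<close> times.\<close>

fun differentiable_upto :: "nat \<Rightarrow> real set \<Rightarrow> (real \<Rightarrow> 'a::real_normed_vector) \<Rightarrow> bool" where
  "differentiable_upto 0 S f \<longleftrightarrow> (\<forall>s\<in>S. f differentiable (at s))"
| "differentiable_upto (Suc n) S f \<longleftrightarrow>
     (\<forall>s\<in>S. f differentiable (at s)) \<and> differentiable_upto n S (D f)"

text \<open>Splitting off the case \<open>m = 0\<close> and moving one \<open>D\<close> next to
  \<open>f\<close> turns the bounded family of iterated derivatives into the recursion.\<close>

lemma differentiable_upto_iff: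
  "differentiable_upto n S f \<longleftrightarrow> (\<forall>m\<le>n. \<forall>s\<in>S. (D ^^ m) f differentiable (at s))"
proof (induction n arbitrary: f)
  case 0
  then show ?case by simp
next
  case (Suc n)
  have split: "(\<forall>m\<le>Suc n. P m) \<longleftrightarrow> P 0 \<and> (\<forall>m\<le>n. P (Suc m))" for P
    using All_less_Suc2[of "Suc n" P] by (simp only: less_Suc_eq_le)
  have pow: "(D ^^ Suc m) f = (D ^^ m) (D f)" for m
    by (simp only: funpow_Suc_right comp_apply)
  show ?case
    unfolding split pow differentiable_upto.simps(2) Suc[of "D f"] funpow_0 ..
qed

lemma smooth_on_iff: "smooth_on S f \<longleftrightarrow> (\<forall>n. differentiable_upto n S f)"
  unfolding smooth_on_def differentiable_upto_iff by blast

lemma differentiable_upto_Suc: "differentiable_upto (Suc n) S f \<Longrightarrow> differentiable_upto n S f"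
  unfolding differentiable_upto_iff by simp

lemma differentiable_upto_has_vector_derivative:
  "differentiable_upto n S f \<Longrightarrow> s \<in> S \<Longrightarrow> (f has_vector_derivative D f s) (at s)"
  by (cases n) (auto simp: vector_derivative_works)

lemma has_vector_derivative_cong_open:
  assumes "open S" "\<And>s. s \<in> S \<Longrightarrow> f s = g s" "s \<in> S"
  shows "(f has_vector_derivative d) (at s) \<longleftrightarrow> (g has_vector_derivative d) (at s)"
  using assms has_vector_derivative_transform_within_open[of f d s S g]
    has_vector_derivative_transform_within_open[of g d s S f] by metis

text \<open>Derivatives at points of an open set are local, so agreement on \<open>S\<close> passes
  to the derivatives. Since \<open>D f\<close> and \<open>D g\<close> may still differ outside
  \<open>S\<close>, the induction has to vary both functions.\<close>

lemma differentiable_upto_cong: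
  assumes "open S" "\<And>s. s \<in> S \<Longrightarrow> f s = g s" "differentiable_upto n S f"
  shows "differentiable_upto n S g"
  using assms(2,3)
proof (induction n arbitrary: f g)
  case 0
  have "(g has_vector_derivative D f s) (at s)" if "s \<in> S" for s
    using has_vector_derivative_cong_open[OF assms(1) 0(1) that]
      differentiable_upto_has_vector_derivative[OF 0(2) that] by auto
  then show ?case by (auto intro: differentiableI_vector)
next
  case (Suc n)
  have g: "(g has_vector_derivative D f s) (at s)" if "s \<in> S" for s
    using has_vector_derivative_cong_open[OF assms(1) Suc.prems(1) that]
      differentiable_upto_has_vector_derivative[OF Suc.prems(2) that] by auto
  then have "D f s = D g s" if "s \<in> S" for s
    using that vector_derivative_at by metis
  then have "differentiable_upto n S (D g)"
    by (rule Suc.IH[of "D f" "D g"]) (use Suc.prems(2) in simp_all)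
  with g show ?case by (auto intro: differentiableI_vector)
qed

text \<open>Lets a calculus rule valid only on \<open>S\<close> stand in for \<open>D f\<close>,
  whose values elsewhere are unknown. The closure inductions below all end with this rule.\<close>

lemma differentiable_upto_SucI:
  assumes "open S" "\<And>s. s \<in> S \<Longrightarrow> (f has_vector_derivative f' s) (at s)"
    and "differentiable_upto n S f'"
  shows "differentiable_upto (Suc n) S f"
proof -
  have "f' s = D f s" if "s \<in> S" for s
    using assms(2)[OF that] vector_derivative_at by metis
  then have "differentiable_upto n S (D f)"
    by (rule differentiable_upto_cong[OF assms(1) _ assms(3)])
  with assms(2) show ?thesis by (auto intro: differentiableI_vector)
qed

lemma differentiable_upto_add:
  assumes "open S" "differentiable_upto n S f" "differentiable_upto n S g"
  shows "differentiable_upto n S (\<lambda>s. f s + g s)"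
  using assms(2,3)
proof (induction n arbitrary: f g)
  case 0
  then show ?case by auto
next
  case (Suc n)
  have "((\<lambda>s. f s + g s) has_vector_derivative D f s + D g s) (at s)" if "s \<in> S" for s
    by (intro has_vector_derivative_add
        Suc.prems[THEN differentiable_upto_has_vector_derivative] that)
  moreover have "differentiable_upto n S (\<lambda>s. D f s + D g s)"
    using Suc.prems by (intro Suc.IH) auto
  ultimately show ?case
    by (rule differentiable_upto_SucI[OF assms(1)])
qed

text \<open>The Leibniz rule pairs each factor with the derivative of the other. The derivatives are
  available at order \<open>n\<close> by the recursion, the undifferentiated factors by lowering
  their order from \<open>Suc n\<close>.\<close>

lemma differentiable_upto_scaleR:
  fixes f :: "real \<Rightarrow> real"
  assumes "open S" "differentiable_upto n S f" "differentiable_upto n S g"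
  shows "differentiable_upto n S (\<lambda>s. f s *\<^sub>R g s)"
  using assms(2,3)
proof (induction n arbitrary: f g)
  case 0
  then show ?case by auto
next
  case (Suc n)
  have "((\<lambda>s. f s *\<^sub>R g s) has_vector_derivative f s *\<^sub>R D g s + D f s *\<^sub>R g s) (at s)"
    if "s \<in> S" for s
    using Suc.prems[THEN differentiable_upto_has_vector_derivative, OF that]
    by (intro has_vector_derivative_scaleR)
      (auto simp: has_real_derivative_iff_has_vector_derivative)
  moreover have "differentiable_upto n S (\<lambda>s. f s *\<^sub>R D g s + D f s *\<^sub>R g s)"
    using Suc.prems Suc.prems[THEN differentiable_upto_Suc]
    by (intro differentiable_upto_add assms(1) Suc.IH) auto
  ultimately show ?case
    by (rule differentiable_upto_SucI[OF assms(1)])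
qed

lemma differentiable_upto_const: "differentiable_upto n S (\<lambda>_. c)"
  by (induction n arbitrary: c) auto

text \<open>The derivative of \<open>1 / f\<close> is \<open>- (1 / f)^2 * D f\<close>. It contains
  \<open>1 / f\<close> again, but is needed only at order \<open>n\<close>, where the induction
  hypothesis for the same \<open>f\<close> covers it.\<close>

lemma differentiable_upto_inverse:
  fixes f :: "real \<Rightarrow> real"
  assumes "open S" "\<And>s. s \<in> S \<Longrightarrow> f s \<noteq> 0" "differentiable_upto n S f"
  shows "differentiable_upto n S (\<lambda>s. inverse (f s))"
  using assms(3)
proof (induction n)
  case 0
  then show ?case using assms(2) by (auto intro!: differentiable_inverse)
next
  case (Suc n)
  \<comment> \<open>Written with scalar products and the constant factor \<open>-1\<close>
    throughout, so that the rules for products and constants alone give its order of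
    differentiability.\<close>
  let ?f' = "\<lambda>s. (-1) *\<^sub>R ((inverse (f s) *\<^sub>R inverse (f s)) *\<^sub>R D f s)"
  have "((\<lambda>s. inverse (f s)) has_vector_derivative ?f' s) (at s)" if "s \<in> S" for s
  proof -
    have "(f has_real_derivative D f s) (at s)"
      using differentiable_upto_has_vector_derivative[OF Suc.prems that]
      by (simp add: has_real_derivative_iff_has_vector_derivative)
    from DERIV_inverse'[OF this assms(2)[OF that]] show ?thesis
      by (simp add: has_real_derivative_iff_has_vector_derivative[symmetric] mult_ac)
  qed
  moreover have "differentiable_upto n S ?f'"
    using Suc.prems Suc.IH[OF Suc.prems[THEN differentiable_upto_Suc]]
    by (intro differentiable_upto_scaleR[OF assms(1)] differentiable_upto_const) auto
  ultimately show ?case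
    by (rule differentiable_upto_SucI[OF assms(1)])
qed

section \<open>Closure properties of smooth functions\<close>

lemma smooth_on_cong:
  "open S \<Longrightarrow> (\<And>s. s \<in> S \<Longrightarrow> f s = g s) \<Longrightarrow> smooth_on S f \<Longrightarrow> smooth_on S g"
  unfolding smooth_on_iff using differentiable_upto_cong[of S f g] by simp

lemma smooth_on_add:
  "open S \<Longrightarrow> smooth_on S f \<Longrightarrow> smooth_on S g \<Longrightarrow> smooth_on S (\<lambda>s. f s + g s)"
  unfolding smooth_on_iff using differentiable_upto_add by blast

lemma smooth_on_scaleR:
  fixes f :: "real \<Rightarrow> real"
  shows "open S \<Longrightarrow> smooth_on S f \<Longrightarrow> smooth_on S g \<Longrightarrow> smooth_on S (\<lambda>s. f s *\<^sub>R g s)"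
  unfolding smooth_on_iff using differentiable_upto_scaleR by blast

lemma smooth_on_const: "smooth_on S (\<lambda>_. c)"
  unfolding smooth_on_iff using differentiable_upto_const by blast

lemma smooth_on_minus:
  assumes "open S" "smooth_on S f"
  shows "smooth_on S (\<lambda>s. - f s)"
  using smooth_on_scaleR[OF assms(1) smooth_on_const[of S "-1"] assms(2)] by simp

lemma smooth_on_mult:
  fixes f g :: "real \<Rightarrow> real"
  shows "open S \<Longrightarrow> smooth_on S f \<Longrightarrow> smooth_on S g \<Longrightarrow> smooth_on S (\<lambda>s. f s * g s)"
  using smooth_on_scaleR[of S f g] by simp

lemma smooth_on_divide:
  fixes f g :: "real \<Rightarrow> real"
  assumes "open S" "smooth_on S f" "smooth_on S g" "\<And>s. s \<in> S \<Longrightarrow> g s \<noteq> 0"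
  shows "smooth_on S (\<lambda>s. f s / g s)"
proof -
  have "smooth_on S (\<lambda>s. inverse (g s))"
    using assms(3,4) differentiable_upto_inverse[OF assms(1)] unfolding smooth_on_iff by blast
  from smooth_on_mult[OF assms(1,2) this] show ?thesis by (simp add: divide_inverse)
qed

text \<open>A constant sign is what keeps the kink of the absolute value away: on all of
  \<open>S\<close> the function is either \<open>f\<close> or \<open>- f\<close>.\<close>

lemma smooth_on_abs:
  fixes f :: "real \<Rightarrow> real"
  assumes "open S" "smooth_on S f" "(\<forall>s\<in>S. f s > 0) \<or> (\<forall>s\<in>S. f s < 0)"
  shows "smooth_on S (\<lambda>s. \<bar>f s\<bar>)"
  using assms(3)
proof
  assume "\<forall>s\<in>S. f s > 0"
  then show ?thesis by (intro smooth_on_cong[OF assms(1) _ assms(2)]) auto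
next
  assume "\<forall>s\<in>S. f s < 0"
  then show ?thesis
    by (intro smooth_on_cong[OF assms(1) _ smooth_on_minus[OF assms(1,2)]]) auto
qed

lemma smooth_on_continuous_on: "smooth_on S f \<Longrightarrow> continuous_on S f"
  by (meson continuous_at_imp_continuous_on differentiable_imp_continuous_within
      smooth_on_differentiable)

section \<open>The frame and curvatures of the evolute\<close>

text \<open>Orthonormality survives permutations and sign changes. The two results are negatives of
  each other and serve the two signs of \<open>\<psi>\<close>.\<close>

lemma orthonormal_frame_reverse:
  assumes "orthonormal_frame e0 e1 e2 e3"
  shows "orthonormal_frame e3 (- e2) e1 e0" "orthonormal_frame (- e3) e2 (- e1) (- e0)"
  using assms by (auto simp: orthonormal_frame_def inner_commute)

theorem proposition23:
  fixes I :: "real set" and x T N1 N2 N3 :: "real \<Rightarrow> real ^ 4"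
    and k1 k2 k3 :: "real \<Rightarrow> real"
  assumes "open I" and "is_interval I"
    and "frenet_apparatus I x T N1 N2 N3 k1 k2 k3"
    and "\<forall>s\<in>I. norm (D x s) = 1"
    and "\<forall>s\<in>I. k1 s \<noteq> 0 \<and> k2 s \<noteq> 0 \<and> k3 s \<noteq> 0"
  shows "let xt = generalized_evolute x N1 N2 N3 k1 k2 k3; \<psi> = evolute_psi k1 k2 k3 in
      smooth_on I \<psi> \<and>
      frenet_apparatus {s\<in>I. \<psi> s > 0} xt
        N3 (\<lambda>s. - N2 s) N1 T
        (\<lambda>s. k3 s / \<bar>\<psi> s\<bar>) (\<lambda>s. k2 s / \<bar>\<psi> s\<bar>) (\<lambda>s. - (k1 s / \<bar>\<psi> s\<bar>)) \<and>
      frenet_apparatus {s\<in>I. \<psi> s < 0} xt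
        (\<lambda>s. - N3 s) N2 (\<lambda>s. - N1 s) (\<lambda>s. - T s)
        (\<lambda>s. k3 s / \<bar>\<psi> s\<bar>) (\<lambda>s. k2 s / \<bar>\<psi> s\<bar>) (\<lambda>s. - (k1 s / \<bar>\<psi> s\<bar>))"
proof -
  define \<psi> where "\<psi> = evolute_psi k1 k2 k3"
  define xt where "xt = generalized_evolute x N1 N2 N3 k1 k2 k3"
  define c1 where "c1 = focal_c1 k1"
  define c2 where "c2 = focal_c2 k1 k2"
  define c3 where "c3 = focal_c3 k1 k2 k3"
  note I = assms(1)
  note fa = assms(3)[unfolded frenet_apparatus_def Let_def]
  have sm: "smooth_on I x" "smooth_on I T" "smooth_on I N1" "smooth_on I N2" "smooth_on I N3"
    "smooth_on I k1" "smooth_on I k2" "smooth_on I k3"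
    by (simp_all only: fa)
  have fr: "orthonormal_frame (T s) (N1 s) (N2 s) (N3 s)"
    "D x s = T s"
    "(T has_vector_derivative k1 s *\<^sub>R N1 s) (at s)"
    "(N1 has_vector_derivative (- k1 s *\<^sub>R T s + k2 s *\<^sub>R N2 s)) (at s)"
    "(N2 has_vector_derivative (- k2 s *\<^sub>R N1 s + k3 s *\<^sub>R N3 s)) (at s)"
    "(N3 has_vector_derivative - (k3 s *\<^sub>R N2 s)) (at s)" if "s \<in> I" for s
  proof -
    \<comment> \<open>Unit speed removes the factor \<open>v\<close> from the Frenet equations and
      the normalization from the tangent.\<close>
    have "norm (D x s) = 1" using assms(4) that by blast
    note fa[THEN conjunct2, THEN conjunct2, THEN conjunct2, THEN conjunct2, THEN conjunct2,
        THEN conjunct2, THEN conjunct2, THEN conjunct2, THEN bspec, OF that, unfolded this]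
    then show "orthonormal_frame (T s) (N1 s) (N2 s) (N3 s)"
      "D x s = T s"
      "(T has_vector_derivative k1 s *\<^sub>R N1 s) (at s)"
      "(N1 has_vector_derivative (- k1 s *\<^sub>R T s + k2 s *\<^sub>R N2 s)) (at s)"
      "(N2 has_vector_derivative (- k2 s *\<^sub>R N1 s + k3 s *\<^sub>R N3 s)) (at s)"
      "(N3 has_vector_derivative - (k3 s *\<^sub>R N2 s)) (at s)"
      by (elim conjE; simp)+
  qed
  have c_eq: "c1 = (\<lambda>s. 1 / k1 s)" "c2 = (\<lambda>s. D c1 s / k2 s)"
    "c3 = (\<lambda>s. (c1 s * k2 s + D c2 s) / k3 s)"
    "\<psi> = (\<lambda>s. c2 s * k3 s + D c3 s)"
    "xt = (\<lambda>s. x s + c1 s *\<^sub>R N1 s + c2 s *\<^sub>R N2 s + c3 s *\<^sub>R N3 s)"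
    by (auto simp: fun_eq_iff c1_def c2_def c3_def \<psi>_def xt_def focal_c1_def focal_c2_def
        focal_c3_def evolute_psi_def generalized_evolute_def)
  \<comment> \<open>Each focal curvature is built from the derivatives of the earlier ones, so
    smoothness is obtained in this order; the nonvanishing of \<open>k1\<close>, \<open>k2\<close>,
    \<open>k3\<close> justifies the divisions.\<close>
  have sc1: "smooth_on I c1"
    unfolding c_eq(1) using assms(5) by (intro smooth_on_divide I smooth_on_const sm) auto
  have sc2: "smooth_on I c2"
    unfolding c_eq(2) using assms(5) by (intro smooth_on_divide I smooth_on_D sc1 sm) auto
  have sc3: "smooth_on I c3"
    unfolding c_eq(3) using assms(5)
    by (intro smooth_on_divide smooth_on_add smooth_on_mult I smooth_on_D sc1 sc2 sm) auto
  have s\<psi>: "smooth_on I \<psi>"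
    unfolding c_eq(4) by (intro smooth_on_add smooth_on_mult I smooth_on_D sc2 sc3 sm)
  have sxt: "smooth_on I xt"
    unfolding c_eq(5) by (intro smooth_on_add smooth_on_scaleR I sc1 sc2 sc3 sm)
  have Dxt: "D xt s = \<psi> s *\<^sub>R N3 s" if s: "s \<in> I" for s
  proof -
    note d = sc1[THEN smooth_on_has_vector_derivative, OF s]
      sc2[THEN smooth_on_has_vector_derivative, OF s]
      sc3[THEN smooth_on_has_vector_derivative, OF s]
    have dx: "(x has_vector_derivative T s) (at s)"
      using smooth_on_has_vector_derivative[OF sm(1) s] fr(2)[OF s] by simp
    have "(xt has_vector_derivative
        T s + (c1 s *\<^sub>R (- k1 s *\<^sub>R T s + k2 s *\<^sub>R N2 s) + D c1 s *\<^sub>R N1 s)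
        + (c2 s *\<^sub>R (- k2 s *\<^sub>R N1 s + k3 s *\<^sub>R N3 s) + D c2 s *\<^sub>R N2 s)
        + (c3 s *\<^sub>R (- (k3 s *\<^sub>R N2 s)) + D c3 s *\<^sub>R N3 s)) (at s)"
      unfolding c_eq(5)
      by (intro has_vector_derivative_add has_vector_derivative_scaleR dx fr(4-6)[OF s]
          d[folded has_real_derivative_iff_has_vector_derivative])
    then have "D xt s =
        T s + (c1 s *\<^sub>R (- k1 s *\<^sub>R T s + k2 s *\<^sub>R N2 s) + D c1 s *\<^sub>R N1 s)
        + (c2 s *\<^sub>R (- k2 s *\<^sub>R N1 s + k3 s *\<^sub>R N3 s) + D c2 s *\<^sub>R N2 s)
        + (c3 s *\<^sub>R (- (k3 s *\<^sub>R N2 s)) + D c3 s *\<^sub>R N3 s)"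
      by (rule vector_derivative_at)
    \<comment> \<open>Collecting terms along the Frenet frame isolates the three coefficients that
      have to vanish.\<close>
    also have "\<dots> = (1 - c1 s * k1 s) *\<^sub>R T s + (D c1 s - c2 s * k2 s) *\<^sub>R N1 s
        + (c1 s * k2 s + D c2 s - c3 s * k3 s) *\<^sub>R N2 s + (c2 s * k3 s + D c3 s) *\<^sub>R N3 s"
      by (simp add: algebra_simps)
    also have "\<dots> = \<psi> s *\<^sub>R N3 s"
    proof -
      \<comment> \<open>These are the definitions of the focal curvatures with denominators cleared;
        they cancel the \<open>T\<close>, \<open>N1\<close> and \<open>N2\<close> components in
        turn.\<close>
      have "c1 s * k1 s = 1" "c2 s * k2 s = D c1 s" "c3 s * k3 s = c1 s * k2 s + D c2 s"
        using assms(5) s c_eq(1-3)[THEN fun_cong, of s] by auto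
      then show ?thesis using c_eq(4)[THEN fun_cong, of s] by simp
    qed
    finally show ?thesis .
  qed
  have speed: "norm (D xt s) = \<bar>\<psi> s\<bar>" if "s \<in> I" for s
    using Dxt[OF that] fr(1)[OF that] by (simp add: orthonormal_frame_def)
  \<comment> \<open>Preimages of open half-lines under the continuous \<open>\<psi>\<close>.
    Openness is required by the closure rules for smoothness.\<close>
  have op: "open {s\<in>I. \<psi> s > 0}" "open {s\<in>I. \<psi> s < 0}"
    using continuous_open_preimage[OF smooth_on_continuous_on[OF s\<psi>] I, of "{0<..}"]
      continuous_open_preimage[OF smooth_on_continuous_on[OF s\<psi>] I, of "{..<0}"]
    by (simp_all add: vimage_def Int_def)
  have sub: "{s\<in>I. \<psi> s > 0} \<subseteq> I" "{s\<in>I. \<psi> s < 0} \<subseteq> I" by auto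
  \<comment> \<open>On either piece \<open>\<psi>\<close> has one sign and no zero, so
    \<open>\<bar>\<psi>\<bar>\<close> is smooth and may be divided by.\<close>
  have curv: "smooth_on S (\<lambda>s. k3 s / \<bar>\<psi> s\<bar>)" "smooth_on S (\<lambda>s. k2 s / \<bar>\<psi> s\<bar>)"
    "smooth_on S (\<lambda>s. - (k1 s / \<bar>\<psi> s\<bar>))"
    if "S = {s\<in>I. \<psi> s > 0} \<or> S = {s\<in>I. \<psi> s < 0}" for S
  proof -
    have S: "open S" "S \<subseteq> I" using that op by auto
    have abs: "smooth_on S (\<lambda>s. \<bar>\<psi> s\<bar>)"
      using that by (intro smooth_on_abs S smooth_on_subset[OF s\<psi>]) auto
    have nz: "\<bar>\<psi> s\<bar> \<noteq> 0" if "s \<in> S" for s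
      using \<open>s \<in> S\<close> \<open>S = _ \<or> _\<close> by auto
    show "smooth_on S (\<lambda>s. k3 s / \<bar>\<psi> s\<bar>)" "smooth_on S (\<lambda>s. k2 s / \<bar>\<psi> s\<bar>)"
      "smooth_on S (\<lambda>s. - (k1 s / \<bar>\<psi> s\<bar>))"
      by (intro smooth_on_minus smooth_on_divide S(1) abs nz sm[THEN smooth_on_subset, OF S(2)];
          assumption)+
  qed
  note sm_pos = sm[THEN smooth_on_subset, OF sub(1)] sxt[THEN smooth_on_subset, OF sub(1)]
  note sm_neg = sm[THEN smooth_on_subset, OF sub(2)] sxt[THEN smooth_on_subset, OF sub(2)]
  \<comment> \<open>The speed \<open>\<bar>\<psi>\<bar>\<close> cancels the denominator of every new
    curvature. What remains is the derivative of \<open>N3\<close>, \<open>N2\<close>,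
    \<open>N1\<close>, \<open>T\<close> in this order, up to a sign for \<open>N2\<close>.\<close>
  have pos: "frenet_apparatus {s\<in>I. \<psi> s > 0} xt N3 (\<lambda>s. - N2 s) N1 T
      (\<lambda>s. k3 s / \<bar>\<psi> s\<bar>) (\<lambda>s. k2 s / \<bar>\<psi> s\<bar>) (\<lambda>s. - (k1 s / \<bar>\<psi> s\<bar>))"
    unfolding frenet_apparatus_def Let_def
  proof (intro conjI ballI)
    show "smooth_on {s\<in>I. \<psi> s > 0} xt"
      "smooth_on {s\<in>I. \<psi> s > 0} N3"
      "smooth_on {s\<in>I. \<psi> s > 0} (\<lambda>s. - N2 s)"
      "smooth_on {s\<in>I. \<psi> s > 0} N1"
      "smooth_on {s\<in>I. \<psi> s > 0} T"
      by (intro sm_pos smooth_on_minus op)+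
    show "smooth_on {s\<in>I. \<psi> s > 0} (\<lambda>s. k3 s / \<bar>\<psi> s\<bar>)"
      "smooth_on {s\<in>I. \<psi> s > 0} (\<lambda>s. k2 s / \<bar>\<psi> s\<bar>)"
      "smooth_on {s\<in>I. \<psi> s > 0} (\<lambda>s. - (k1 s / \<bar>\<psi> s\<bar>))"
      by (rule curv; simp)+
  next
    fix s assume "s \<in> {s\<in>I. \<psi> s > 0}"
    then have s: "s \<in> I" "\<psi> s > 0" by auto
    note n = speed[OF s(1)]
    show "orthonormal_frame (N3 s) (- N2 s) (N1 s) (T s)"
      by (rule orthonormal_frame_reverse fr s)+
    show "D xt s \<noteq> 0" using n s by auto
    show "N3 s = D xt s /\<^sub>R norm (D xt s)" unfolding n unfolding Dxt[OF s(1)] using s by simp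
    show "(N3 has_vector_derivative norm (D xt s) *\<^sub>R ((k3 s / \<bar>\<psi> s\<bar>) *\<^sub>R - N2 s)) (at s)"
      using fr(6)[OF s(1)] s unfolding n by simp
    show "((\<lambda>s. - N2 s) has_vector_derivative
        norm (D xt s) *\<^sub>R (- (k3 s / \<bar>\<psi> s\<bar>) *\<^sub>R N3 s + (k2 s / \<bar>\<psi> s\<bar>) *\<^sub>R N1 s)) (at s)"
      using has_vector_derivative_minus[OF fr(5)[OF s(1)]] s unfolding n
      by (simp add: scaleR_right_distrib scaleR_right_diff_distrib)
    \<comment> \<open>The component of the derivative of \<open>N1\<close> along \<open>T\<close> is
      \<open>- k1\<close>; with \<open>T\<close> as last frame vector this forces the minus sign in
      the third curvature.\<close>
    show "(N1 has_vector_derivative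
        norm (D xt s) *\<^sub>R (- (k2 s / \<bar>\<psi> s\<bar>) *\<^sub>R - N2 s + (- (k1 s / \<bar>\<psi> s\<bar>)) *\<^sub>R T s)) (at s)"
      using fr(4)[OF s(1)] s unfolding n
      by (simp add: scaleR_right_distrib scaleR_right_diff_distrib)
    show "(T has_vector_derivative
        - (norm (D xt s) * - (k1 s / \<bar>\<psi> s\<bar>)) *\<^sub>R N1 s) (at s)"
      using fr(3)[OF s(1)] s unfolding n by simp
  qed
  \<comment> \<open>Here the unit tangent is \<open>- N3\<close>. Negating all four frame vectors of
    the positive case preserves the Frenet equations, which are linear in the frame, so the
    curvatures keep the same formulas.\<close>
  have neg: "frenet_apparatus {s\<in>I. \<psi> s < 0} xt (\<lambda>s. - N3 s) N2 (\<lambda>s. - N1 s) (\<lambda>s. - T s)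
      (\<lambda>s. k3 s / \<bar>\<psi> s\<bar>) (\<lambda>s. k2 s / \<bar>\<psi> s\<bar>) (\<lambda>s. - (k1 s / \<bar>\<psi> s\<bar>))"
    unfolding frenet_apparatus_def Let_def
  proof (intro conjI ballI)
    show "smooth_on {s\<in>I. \<psi> s < 0} xt"
      "smooth_on {s\<in>I. \<psi> s < 0} (\<lambda>s. - N3 s)"
      "smooth_on {s\<in>I. \<psi> s < 0} N2"
      "smooth_on {s\<in>I. \<psi> s < 0} (\<lambda>s. - N1 s)"
      "smooth_on {s\<in>I. \<psi> s < 0} (\<lambda>s. - T s)"
      by (intro sm_neg smooth_on_minus op)+
    show "smooth_on {s\<in>I. \<psi> s < 0} (\<lambda>s. k3 s / \<bar>\<psi> s\<bar>)"
      "smooth_on {s\<in>I. \<psi> s < 0} (\<lambda>s. k2 s / \<bar>\<psi> s\<bar>)"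
      "smooth_on {s\<in>I. \<psi> s < 0} (\<lambda>s. - (k1 s / \<bar>\<psi> s\<bar>))"
      by (rule curv; simp)+
  next
    fix s assume "s \<in> {s\<in>I. \<psi> s < 0}"
    then have s: "s \<in> I" "\<psi> s < 0" by auto
    note n = speed[OF s(1)]
    show "orthonormal_frame (- N3 s) (N2 s) (- N1 s) (- T s)"
      by (rule orthonormal_frame_reverse fr s)+
    show "D xt s \<noteq> 0" using n s by auto
    show "- N3 s = D xt s /\<^sub>R norm (D xt s)" unfolding n unfolding Dxt[OF s(1)] using s by simp
    show "((\<lambda>s. - N3 s) has_vector_derivative
        norm (D xt s) *\<^sub>R ((k3 s / \<bar>\<psi> s\<bar>) *\<^sub>R N2 s)) (at s)"
      using has_vector_derivative_minus[OF fr(6)[OF s(1)]] s unfolding n by simp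
    show "(N2 has_vector_derivative
        norm (D xt s) *\<^sub>R (- (k3 s / \<bar>\<psi> s\<bar>) *\<^sub>R - N3 s + (k2 s / \<bar>\<psi> s\<bar>) *\<^sub>R - N1 s)) (at s)"
      using fr(5)[OF s(1)] s unfolding n
      by (simp add: scaleR_right_distrib scaleR_right_diff_distrib)
    show "((\<lambda>s. - N1 s) has_vector_derivative
        norm (D xt s) *\<^sub>R (- (k2 s / \<bar>\<psi> s\<bar>) *\<^sub>R N2 s + (- (k1 s / \<bar>\<psi> s\<bar>)) *\<^sub>R - T s)) (at s)"
      using has_vector_derivative_minus[OF fr(4)[OF s(1)]] s unfolding n
      by (simp add: scaleR_right_distrib scaleR_right_diff_distrib)
    show "((\<lambda>s. - T s) has_vector_derivative
        - (norm (D xt s) * - (k1 s / \<bar>\<psi> s\<bar>)) *\<^sub>R - N1 s) (at s)"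
      using has_vector_derivative_minus[OF fr(3)[OF s(1)]] s unfolding n by simp
  qed
  show ?thesis
    using s\<psi> pos neg unfolding \<psi>_def xt_def Let_def by blast
qed

end
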